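(* Let $f:X\to Y$ be a smooth map between diffeological spaces, let $f(X)\subseteq Y$ carry the subspace diffeology, and let $\dim$ denote the diffeological dimension. (S') If $f$ is a diffeological submersion, then $\dim(X)\ge\dim(f(X))$. (I') If $f$ is a diffeological immersion, then $\dim(X)\le\dim(Y)$. (E') If $f$ is a diffeological étale map, then $\dim(X)=\dim(f(X))\le\dim(Y)$.
   Context: An $n$-domain is an open subset of $\mathbb{R}^n$; a domain is an $n$-domain for some $n\ge 0$. A parametrization in a set $X$ is a map from a domain to $X$. A diffeology on $X$ is a set $\mathcal{D}$ of parametrizations in $X$ such that: (D1) the images of the elements of $\mathcal{D}$ cover $X$; (D2) $P\circ F\in\mathcal{D}$ for every $P:U\to X$ in $\mathcal{D}$ and every smooth map $F:V\to U$ between domains; (D3) if a family of $n$-parametrizations $P_i:U_i\to X$ in $\mathcal{D}$ agree on overlaps, their common extension to $\bigcup_i U_i$ is in $\mathcal{D}$. A diffeological space is a set with a diffeology, whose elements are called plots. A map $f:X\to Y$ is smooth if $f\circ P$ is a plot in $Y$ for every plot $P$ in $X$; a diffeomorphism is a smooth bijection with smooth inverse. A subset of $X$ is D-open if its preimage under every plot is open; this defines the D-topology. Subsets carry the subspace diffeology (plots with values in the subset), and the plots of a product are the tuples of plots. Domains carry their usual smooth parametrizations as plots. For smooth maps $f:X\to Y$ and $g:Z\to Y$, the pullback of $f$ by $g$ is $g^*f:g^*X\to Z$, $(z,x)\mapsto z$, where $g^*X=\{(z,x)\in Z\times X: g(z)=f(x)\}$. Dimension: a covering generating family of $X$ is a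 set $\mathcal{G}$ of parametrizations in $X$ whose images cover $X$ and which generates the diffeology of $X$, i.e. the plots of $X$ are exactly the parametrizations that are locally (near each point of their domain) of the form $P\circ F$ with $P\in\mathcal{G}$ and $F$ a smooth map between domains. Put $\dim(\mathcal{G})=\sup_{P\in\mathcal{G}}\dim(\mathrm{dom}(P))$, and $\dim(X)=\inf_{\mathcal{G}}\dim(\mathcal{G})$, the infimum over all covering generating families of $X$ ($\dim(X)=\infty$ if none has finite dimension). Submersion: a smooth map $f:X\to Y$ such that for each $x_0\in X$ there are a D-open $O\subseteq Y$ and a smooth map $\sigma:O\to X$ with $f\circ\sigma(y)=y$ for all $y\in O$ and $x_0\in\sigma(O)$. Diffeological submersion: a smooth map $f:X\to Y$ whose pullback $P^*f$ by every plot $P$ in $Y$ is a submersion. Diffeological immersion: a smooth map $f:X\to Y$ such that for every plot $P:U\to Y$ and every $(r_0,x_0)\in P^*X$ there exist a D-open neighborhood $O$ of $(r_0,x_0)$ in $P^*X$, an open neighborhood $V\subseteq U$ of $P^*f(O)$ and a smooth map $\varrho:V\to U\times X$ such that $\varrho\circ P^*f(r,x)=(r,x)$ for all $(r,x)\in O$. Étale map: a map $f:X\to Y$ such that every $x_0\in X$ has a D-open neighborhood $O\subseteq X$, and $f(x_0)$ a D-open neighborhood $O'\subseteq Y$, with $f|_O:O\to O'$ a diffeomorphism. Diffeological étale map: a smooth map whose pullback by every plot in the target is étale. *)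

theory Defs
  imports "HOL-Analysis.Analysis" "HOL-Library.Extended_Nat"
begin

text \<open>
  \<open>\<real>\<^sup>n\<close> is \<^const>\<open>Euclidean_space\<close> \<open>n\<close>, i.e. the functions \<open>nat \<Rightarrow> real\<close> that vanish at all
  indices \<open>\<ge> n\<close>, so that domains of all dimensions live in one type. The empty set is an
  \<open>n\<close>-domain for every \<open>n\<close>.
\<close>

definition is_domain :: "nat \<Rightarrow> (nat \<Rightarrow> real) set \<Rightarrow> bool" where
  "is_domain n U \<longleftrightarrow> openin (Euclidean_space n) U"

text \<open>
  Functions of class \<open>C\<^sup>k\<close>: continuous, with all \<open>n\<close> first order partial derivatives existing on
  \<open>U\<close> and of class \<open>C\<^sup>k\<^sup>-\<^sup>1\<close>. For an \<open>n\<close>-domain \<open>U\<close> this only depends on the values of \<open>h\<close> on \<open>U\<close>.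
\<close>

primrec Ck_on :: "nat \<Rightarrow> (nat \<Rightarrow> real) set \<Rightarrow> nat \<Rightarrow> ((nat \<Rightarrow> real) \<Rightarrow> real) \<Rightarrow> bool" where
  "Ck_on n U 0 h \<longleftrightarrow> continuous_map (subtopology (Euclidean_space n) U) euclideanreal h"
| "Ck_on n U (Suc k) h \<longleftrightarrow>
     continuous_map (subtopology (Euclidean_space n) U) euclideanreal h \<and>
     (\<forall>i<n. \<exists>g. (\<forall>x\<in>U. ((\<lambda>t. h (x(i := t))) has_real_derivative g x) (at (x i))) \<and>
                 Ck_on n U k g)"

definition smooth_between ::
  "nat \<Rightarrow> (nat \<Rightarrow> real) set \<Rightarrow> nat \<Rightarrow> (nat \<Rightarrow> real) set \<Rightarrow> ((nat \<Rightarrow> real) \<Rightarrow> (nat \<Rightarrow> real)) \<Rightarrow> bool"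
where
  "smooth_between m V n U F \<longleftrightarrow>
     is_domain m V \<and> is_domain n U \<and> F ` V \<subseteq> U \<and> (\<forall>j<n. \<forall>k. Ck_on m V k (\<lambda>x. F x j))"

text \<open>
  A parametrization with \<open>n\<close>-domain \<open>U\<close> is encoded as a triple \<open>(n, U, P)\<close>, where only the values
  of the total function \<open>P\<close> on \<open>U\<close> are relevant: the third axiom of a diffeology, applied to a
  family with one member, makes the set of plots closed under changing \<open>P\<close> outside \<open>U\<close>.
\<close>

type_synonym 'a parametrization = "nat \<times> (nat \<Rightarrow> real) set \<times> ((nat \<Rightarrow> real) \<Rightarrow> 'a)"

definition parametrizations :: "'a set \<Rightarrow> 'a parametrization set" where
  "parametrizations A = {(n, U, P). is_domain n U \<and> P ` U \<subseteq> A}"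

record 'a dspace =
  points :: "'a set"
  plots :: "'a parametrization set"

definition images_cover :: "'a parametrization set \<Rightarrow> 'a set \<Rightarrow> bool" where
  "images_cover \<G> A \<longleftrightarrow> (\<Union>(n, U, P)\<in>\<G>. P ` U) = A"

text \<open>
  In the third axiom the family is a set \<open>\<F>\<close> of pairs \<open>(U, P)\<close>; agreement on overlaps is the same
  as the existence of the common extension \<open>Q\<close>, whose values outside the union are arbitrary.
\<close>

definition diffeological_space :: "'a dspace \<Rightarrow> bool" where
  "diffeological_space X \<longleftrightarrow>
     plots X \<subseteq> parametrizations (points X) \<and>
     images_cover (plots X) (points X) \<and>
     (\<forall>n U P m V F. (n, U, P) \<in> plots X \<longrightarrow> smooth_between m V n U F \<longrightarrow>
        (m, V, P \<circ> F) \<in> plots X) \<and>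
     (\<forall>n \<F> Q. (\<forall>(U, P)\<in>\<F>. (n, U, P) \<in> plots X \<and> (\<forall>x\<in>U. Q x = P x)) \<longrightarrow>
        (n, \<Union>(fst ` \<F>), Q) \<in> plots X)"

definition smooth_map :: "'a dspace \<Rightarrow> 'b dspace \<Rightarrow> ('a \<Rightarrow> 'b) \<Rightarrow> bool" where
  "smooth_map X Y f \<longleftrightarrow>
     f ` points X \<subseteq> points Y \<and>
     (\<forall>n U P. (n, U, P) \<in> plots X \<longrightarrow> (n, U, f \<circ> P) \<in> plots Y)"

definition diffeomorphism :: "'a dspace \<Rightarrow> 'b dspace \<Rightarrow> ('a \<Rightarrow> 'b) \<Rightarrow> bool" where
  "diffeomorphism X Y f \<longleftrightarrow>
     bij_betw f (points X) (points Y) \<and> smooth_map X Y f \<and>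
     smooth_map Y X (inv_into (points X) f)"

definition d_open :: "'a dspace \<Rightarrow> 'a set \<Rightarrow> bool" where
  "d_open X A \<longleftrightarrow>
     A \<subseteq> points X \<and> (\<forall>(n, U, P)\<in>plots X. openin (Euclidean_space n) {r \<in> U. P r \<in> A})"

definition subspace_of :: "'a dspace \<Rightarrow> 'a set \<Rightarrow> 'a dspace" where
  "subspace_of X A =
     \<lparr>points = points X \<inter> A, plots = {(n, U, P) \<in> plots X. P ` U \<subseteq> A}\<rparr>"

definition product_space :: "'a dspace \<Rightarrow> 'b dspace \<Rightarrow> ('a \<times> 'b) dspace" where
  "product_space X Y =
     \<lparr>points = points X \<times> points Y,
      plots = {(n, U, P). (n, U, fst \<circ> P) \<in> plots X \<and> (n, U, snd \<circ> P) \<in> plots Y}\<rparr>"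

definition domain_space :: "nat \<Rightarrow> (nat \<Rightarrow> real) set \<Rightarrow> (nat \<Rightarrow> real) dspace" where
  "domain_space n U = \<lparr>points = U, plots = {(m, V, F). smooth_between m V n U F}\<rparr>"

text \<open>
  The total space of the pullback of \<open>f : X \<rightarrow> Y\<close> by \<open>g : Z \<rightarrow> Y\<close>; the pullback map itself is
  \<^const>\<open>fst\<close> on this space.
\<close>

definition pullback_space ::
  "'a dspace \<Rightarrow> ('a \<Rightarrow> 'b) \<Rightarrow> 'c dspace \<Rightarrow> ('c \<Rightarrow> 'b) \<Rightarrow> ('c \<times> 'a) dspace"
where
  "pullback_space X f Z g =
     subspace_of (product_space Z X) {(z, x). z \<in> points Z \<and> x \<in> points X \<and> g z = f x}"

definition locally_factors ::
  "'a parametrization set \<Rightarrow> 'a parametrization \<Rightarrow> bool"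
where
  "locally_factors \<G> = (\<lambda>(n, U, Q).
     \<forall>r\<in>U. \<exists>V. is_domain n V \<and> r \<in> V \<and> V \<subseteq> U \<and>
       (\<exists>(m, W, P)\<in>\<G>. \<exists>F. smooth_between n V m W F \<and> (\<forall>s\<in>V. Q s = P (F s))))"

definition covering_generating_family :: "'a dspace \<Rightarrow> 'a parametrization set \<Rightarrow> bool" where
  "covering_generating_family X \<G> \<longleftrightarrow>
     \<G> \<subseteq> parametrizations (points X) \<and>
     images_cover \<G> (points X) \<and>
     plots X = {p \<in> parametrizations (points X). locally_factors \<G> p}"

text \<open>Sup {} = 0 in \<^typ>\<open>enat\<close>, so the empty space has dimension \<open>0\<close>.\<close>

definition family_dim :: "'a parametrization set \<Rightarrow> enat" where
  "family_dim \<G> = (SUP (n, U, P)\<in>\<G>. enat n)"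

definition diffeological_dim :: "'a dspace \<Rightarrow> enat" where
  "diffeological_dim X = (INF \<G>\<in>{\<G>. covering_generating_family X \<G>}. family_dim \<G>)"

definition submersion :: "'a dspace \<Rightarrow> 'b dspace \<Rightarrow> ('a \<Rightarrow> 'b) \<Rightarrow> bool" where
  "submersion X Y f \<longleftrightarrow>
     smooth_map X Y f \<and>
     (\<forall>x0\<in>points X. \<exists>A \<sigma>. d_open Y A \<and> smooth_map (subspace_of Y A) X \<sigma> \<and>
        (\<forall>y\<in>A. f (\<sigma> y) = y) \<and> x0 \<in> \<sigma> ` A)"

definition diffeological_submersion :: "'a dspace \<Rightarrow> 'b dspace \<Rightarrow> ('a \<Rightarrow> 'b) \<Rightarrow> bool" where
  "diffeological_submersion X Y f \<longleftrightarrow>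
     smooth_map X Y f \<and>
     (\<forall>(n, U, P)\<in>plots Y.
        submersion (pullback_space X f (domain_space n U) P) (domain_space n U) fst)"

definition diffeological_immersion :: "'a dspace \<Rightarrow> 'b dspace \<Rightarrow> ('a \<Rightarrow> 'b) \<Rightarrow> bool" where
  "diffeological_immersion X Y f \<longleftrightarrow>
     smooth_map X Y f \<and>
     (\<forall>(n, U, P)\<in>plots Y. \<forall>p0\<in>points (pullback_space X f (domain_space n U) P).
        \<exists>A V \<rho>. d_open (pullback_space X f (domain_space n U) P) A \<and> p0 \<in> A \<and>
          is_domain n V \<and> V \<subseteq> U \<and> fst ` A \<subseteq> V \<and>
          smooth_map (domain_space n V) (product_space (domain_space n U) X) \<rho> \<and>
          (\<forall>p\<in>A. \<rho> (fst p) = p))"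

definition etale_map :: "'a dspace \<Rightarrow> 'b dspace \<Rightarrow> ('a \<Rightarrow> 'b) \<Rightarrow> bool" where
  "etale_map X Y f \<longleftrightarrow>
     f ` points X \<subseteq> points Y \<and>
     (\<forall>x0\<in>points X. \<exists>A B. d_open X A \<and> x0 \<in> A \<and> d_open Y B \<and> f x0 \<in> B \<and>
        diffeomorphism (subspace_of X A) (subspace_of Y B) f)"

definition diffeological_etale_map :: "'a dspace \<Rightarrow> 'b dspace \<Rightarrow> ('a \<Rightarrow> 'b) \<Rightarrow> bool" where
  "diffeological_etale_map X Y f \<longleftrightarrow>
     smooth_map X Y f \<and>
     (\<forall>(n, U, P)\<in>plots Y.
        etale_map (pullback_space X f (domain_space n U) P) (domain_space n U) fst)"

end

theory Submission
  imports Defs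
begin

text \<open>
  For (S'), composing with \<open>f\<close> turns a generating family of \<open>X\<close> into one of \<open>f(X)\<close>: local sections
  of the pullback by a plot of \<open>f(X)\<close> are local lifts of that plot to \<open>X\<close>.
  For (I'), let \<open>Q\<close> be a plot of \<open>X\<close> and let \<open>f \<circ> Q = P \<circ> F\<close> locally, with \<open>P\<close> in a generating
  family of \<open>Y\<close>. The local retraction \<open>\<rho>\<close> of the pullback by \<open>P\<close> gives \<open>Q = snd \<circ> \<rho> \<circ> F\<close>, so \<open>Q\<close>
  factors locally through the plot \<open>snd \<circ> \<rho>\<close> of \<open>X\<close>, whose domain has the dimension of that of \<open>P\<close>.
  A diffeological etale map is both kinds of map, and it remains an immersion onto its image.
\<close>

section \<open>Smooth maps between domains\<close>

lemma Ck_on_const: "Ck_on n U k (\<lambda>x. c)"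
proof (induction k arbitrary: c)
  case (Suc k)
  have "\<exists>g. (\<forall>x\<in>U. ((\<lambda>t. c) has_real_derivative g x) (at (x i))) \<and> Ck_on n U k g" for i
    using Suc[of 0] by (intro exI[of _ "\<lambda>x. 0"]) auto
  then show ?case by simp
qed simp

lemma continuous_map_Euclidean_component:
  "continuous_map (subtopology (Euclidean_space n) U) euclideanreal (\<lambda>x. x j)"
  unfolding Euclidean_space_def
  by (intro continuous_map_from_subtopology continuous_map_product_projection) simp

text \<open>The partial derivatives of a coordinate are the constants 0 and 1, so a single
  differentiation reduces everything to \<open>Ck_on_const\<close>.\<close>

lemma Ck_on_component: "Ck_on n U k (\<lambda>x. x j)"
proof (cases k)
  case (Suc k')
  have "\<exists>g. (\<forall>x\<in>U. ((\<lambda>t. (x(i := t)) j) has_real_derivative g x) (at (x i))) \<and> Ck_on n U k' g" for i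
    by (intro exI[of _ "\<lambda>x. if i = j then 1 else 0"]) (auto simp: Ck_on_const)
  then show ?thesis
    using continuous_map_Euclidean_component by (auto simp: Suc simp del: fun_upd_apply)
qed (simp add: continuous_map_Euclidean_component)

lemma Ck_on_subset:
  assumes "Ck_on n U k h" "V \<subseteq> U"
  shows "Ck_on n V k h"
  using assms
proof (induction k arbitrary: h)
  case 0
  then show ?case by (auto intro: continuous_map_from_subtopology_mono)
next
  case (Suc k)
  then have "continuous_map (subtopology (Euclidean_space n) V) euclideanreal h"
    by (auto intro: continuous_map_from_subtopology_mono)
  with Suc show ?case by simp (meson subsetD)
qed

text \<open>Inclusions of open subsets are smooth; composing with them restricts plots to smaller
  domains, and with \<open>V = U\<close> it makes the identity available as a test plot.\<close>

lemma smooth_between_id: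
  assumes "is_domain n V" "is_domain n U" "V \<subseteq> U"
  shows "smooth_between n V n U (\<lambda>x. x)"
  using assms by (auto simp: smooth_between_def Ck_on_component)

lemma smooth_between_subset:
  assumes "smooth_between m V n U F" "is_domain m V'" "V' \<subseteq> V" "is_domain n U'" "F ` V' \<subseteq> U'"
  shows "smooth_between m V' n U' F"
  using assms unfolding smooth_between_def by (meson Ck_on_subset)

section \<open>Plots and generating families\<close>

lemma images_cover_iff:
  "images_cover \<G> A \<longleftrightarrow> (\<forall>n U P. (n, U, P) \<in> \<G> \<longrightarrow> P ` U \<subseteq> A) \<and>
     (\<forall>x\<in>A. \<exists>n U P. (n, U, P) \<in> \<G> \<and> x \<in> P ` U)"
proof -
  have "(\<Union>(n, U, P)\<in>\<G>. P ` U) = {x. \<exists>n U P. (n, U, P) \<in> \<G> \<and> x \<in> P ` U}"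
    by auto
  then show ?thesis unfolding images_cover_def by blast
qed

lemma plots_parametrization:
  assumes "diffeological_space X" "(n, U, P) \<in> plots X"
  shows "is_domain n U" "P ` U \<subseteq> points X"
  using assms by (auto simp: diffeological_space_def parametrizations_def)

lemma points_covered:
  assumes "diffeological_space X" "x \<in> points X"
  obtains n U P r where "(n, U, P) \<in> plots X" "r \<in> U" "x = P r"
proof -
  have "images_cover (plots X) (points X)"
    using assms(1) by (simp add: diffeological_space_def)
  then show ?thesis using assms(2) that unfolding images_cover_iff by blast
qed

lemma plots_comp:
  assumes "diffeological_space X" "(n, U, P) \<in> plots X" "smooth_between m V n U F"
  shows "(m, V, P \<circ> F) \<in> plots X"
  using assms(1)[unfolded diffeological_space_def] assms(2,3) by meson

lemma plots_glue:
  assumes "diffeological_space X"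
    and "\<And>U P. (U, P) \<in> \<F> \<Longrightarrow> (n, U, P) \<in> plots X \<and> (\<forall>x\<in>U. Q x = P x)"
  shows "(n, \<Union>(fst ` \<F>), Q) \<in> plots X"
proof -
  have "\<forall>(U, P)\<in>\<F>. (n, U, P) \<in> plots X \<and> (\<forall>x\<in>U. Q x = P x)"
    using assms(2) by blast
  then show ?thesis using assms(1) by (simp add: diffeological_space_def)
qed

lemma plots_restrict:
  assumes "diffeological_space X" "(n, U, P) \<in> plots X" "is_domain n V" "V \<subseteq> U"
  shows "(n, V, P) \<in> plots X"
  using plots_comp[OF assms(1,2) smooth_between_id] assms plots_parametrization(1)[OF assms(1,2)]
  by (simp add: comp_def)

section \<open>Local factorization through a family of plots\<close>

lemma locally_factors_iff:
  "locally_factors \<G> (n, U, Q) \<longleftrightarrow>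
     (\<forall>r\<in>U. \<exists>V m W P F. is_domain n V \<and> r \<in> V \<and> V \<subseteq> U \<and> (m, W, P) \<in> \<G> \<and>
        smooth_between n V m W F \<and> (\<forall>s\<in>V. Q s = P (F s)))"
  by (simp add: locally_factors_def Bex_def split_paired_Ex)

lemma locally_factorsE:
  assumes "locally_factors \<G> (n, U, Q)" "r \<in> U"
  obtains V m W P F where "is_domain n V" "r \<in> V" "V \<subseteq> U" "(m, W, P) \<in> \<G>"
    "smooth_between n V m W F" "\<And>s. s \<in> V \<Longrightarrow> Q s = P (F s)"
  using assms unfolding locally_factors_iff by metis

text \<open>Each local piece \<open>P \<circ> F\<close> is a plot by the composition axiom, and the
  gluing axiom assembles the pieces.\<close>

lemma locally_factors_plot:
  assumes X: "diffeological_space X" and \<G>: "\<G> \<subseteq> plots X"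
    and Q: "locally_factors \<G> (n, U, Q)"
  shows "(n, U, Q) \<in> plots X"
proof -
  \<comment> \<open>All plots that agree with \<open>Q\<close> on a subset of \<open>U\<close> are
    taken at once, so no piece has to be chosen for each point. The condition
    \<open>V \<subseteq> U\<close> keeps the union inside \<open>U\<close>.\<close>
  define \<F> where "\<F> = {(V, R). V \<subseteq> U \<and> (n, V, R) \<in> plots X \<and> (\<forall>x\<in>V. Q x = R x)}"
  have "r \<in> \<Union>(fst ` \<F>)" if "r \<in> U" for r
  proof -
    from Q that obtain V m W P F where *: "is_domain n V" "r \<in> V" "V \<subseteq> U" "(m, W, P) \<in> \<G>"
      "smooth_between n V m W F" "\<And>s. s \<in> V \<Longrightarrow> Q s = P (F s)"
      by (rule locally_factorsE) blast
    then have "(n, V, P \<circ> F) \<in> plots X" using X \<G> plots_comp by blast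
    with * have "(V, P \<circ> F) \<in> \<F>" by (simp add: \<F>_def)
    then have "V \<in> fst ` \<F>" by (rule image_eqI[rotated]) simp
    with \<open>r \<in> V\<close> show ?thesis by blast
  qed
  then have "U \<subseteq> \<Union>(fst ` \<F>)" by blast
  moreover have "\<Union>(fst ` \<F>) \<subseteq> U" by (auto simp: \<F>_def)
  moreover have "(n, \<Union>(fst ` \<F>), Q) \<in> plots X"
    by (rule plots_glue[OF X]) (simp add: \<F>_def)
  ultimately show ?thesis by (simp add: subset_antisym)
qed

text \<open>Every member factors through itself via the identity of its domain.\<close>

lemma generating_family_subset_plots:
  assumes "covering_generating_family X \<G>"
  shows "\<G> \<subseteq> plots X"
proof
  fix p assume p: "p \<in> \<G>"
  obtain n U P where [simp]: "p = (n, U, P)" by (cases p)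
  have par: "p \<in> parametrizations (points X)"
    using assms p by (auto simp: covering_generating_family_def)
  then have U: "is_domain n U" by (simp add: parametrizations_def)
  have "locally_factors \<G> (n, U, P)"
    unfolding locally_factors_iff
  proof
    fix r assume "r \<in> U"
    with U p smooth_between_id[OF U U order_refl]
    show "\<exists>V m W P' F. is_domain n V \<and> r \<in> V \<and> V \<subseteq> U \<and> (m, W, P') \<in> \<G> \<and>
        smooth_between n V m W F \<and> (\<forall>s\<in>V. P s = P' (F s))"
      by (intro exI[of _ U] exI[of _ n] exI[of _ P] exI[of _ "\<lambda>x. x"]) simp
  qed
  with par show "p \<in> plots X" using assms by (simp add: covering_generating_family_def)
qed

lemma generating_family_locally_factors:
  assumes "covering_generating_family X \<G>" "(n, U, Q) \<in> plots X"
  shows "locally_factors \<G> (n, U, Q)"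
  using assms by (simp add: covering_generating_family_def)

text \<open>For a family of plots only the factorization of plots has to be checked. Covering
  follows because every point is a value of some plot, which factors near it through a member; the
  remaining inclusion is \<open>locally_factors_plot\<close>.\<close>

lemma covering_generating_familyI:
  assumes X: "diffeological_space X" and \<G>: "\<G> \<subseteq> plots X"
    and lf: "\<And>n U Q. (n, U, Q) \<in> plots X \<Longrightarrow> locally_factors \<G> (n, U, Q)"
  shows "covering_generating_family X \<G>"
proof -
  have par: "plots X \<subseteq> parametrizations (points X)"
    using X by (simp add: diffeological_space_def)
  have "\<exists>n U P. (n, U, P) \<in> \<G> \<and> x \<in> P ` U" if "x \<in> points X" for x
  proof -
    from X that obtain n U Q r where Q: "(n, U, Q) \<in> plots X" "r \<in> U" "x = Q r"
      by (rule points_covered)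
    from lf[OF Q(1)] Q(2) obtain V m W P F where
      "is_domain n V" "r \<in> V" "V \<subseteq> U" and P: "(m, W, P) \<in> \<G>"
      and "smooth_between n V m W F" "\<And>s. s \<in> V \<Longrightarrow> Q s = P (F s)"
      by (rule locally_factorsE) blast
    \<comment> \<open>Here \<open>x = Q r = P (F r)\<close> with \<open>F r\<close> in
      \<open>W\<close>.\<close>
    then have "x \<in> P ` W" using Q(3) by (auto simp: smooth_between_def)
    with P show ?thesis by blast
  qed
  moreover have "P ` U \<subseteq> points X" if "(n, U, P) \<in> \<G>" for n U P
    using plots_parametrization(2)[OF X] \<G> that by blast
  ultimately have "images_cover \<G> (points X)" unfolding images_cover_iff by blast
  moreover have "plots X = {p \<in> parametrizations (points X). locally_factors \<G> p}"
    using par lf locally_factors_plot[OF X \<G>] by auto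
  ultimately show ?thesis using par \<G> by (auto simp: covering_generating_family_def)
qed

text \<open>\<open>family_dim\<close> depends only on the set of dimensions of the domains, so it
  suffices to turn each generating family of \<open>X\<close> into one of \<open>Y\<close> in which
  no new dimension occurs. Infinite suprema need no separate treatment.\<close>

lemma diffeological_dim_mono:
  assumes "\<And>\<G>. covering_generating_family X \<G> \<Longrightarrow>
    \<exists>\<H>. covering_generating_family Y \<H> \<and> fst ` \<H> \<subseteq> fst ` \<G>"
  shows "diffeological_dim Y \<le> diffeological_dim X"
  unfolding diffeological_dim_def
proof (rule INF_mono)
  fix \<G> assume "\<G> \<in> {\<G>. covering_generating_family X \<G>}"
  with assms obtain \<H> where \<H>: "covering_generating_family Y \<H>" "fst ` \<H> \<subseteq> fst ` \<G>" by blast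
  have "family_dim \<H> \<le> family_dim \<G>"
    using SUP_subset_mono[OF \<H>(2), of enat enat]
    by (simp add: family_dim_def image_image case_prod_beta)
  with \<H>(1) show "\<exists>\<H>\<in>{\<G>. covering_generating_family Y \<G>}. family_dim \<H> \<le> family_dim \<G>" by blast
qed

text \<open>The plots \<open>f \<circ> P\<close>, for \<open>P\<close> a plot of \<open>X\<close>,
  cover the image. Composition and gluing are inherited from \<open>Y\<close>, since both preserve
  having values in the image.\<close>

lemma diffeological_space_image:
  assumes X: "diffeological_space X" and Y: "diffeological_space Y" and f: "smooth_map X Y f"
  shows "diffeological_space (subspace_of Y (f ` points X))"
proof -
  let ?Z = "subspace_of Y (f ` points X)"
  have pts: "points ?Z = f ` points X"
    using f by (auto simp: subspace_of_def smooth_map_def)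
  have plt: "(n, U, P) \<in> plots ?Z \<longleftrightarrow> (n, U, P) \<in> plots Y \<and> P ` U \<subseteq> f ` points X" for n U P
    by (simp add: subspace_of_def)
  have "\<exists>n U P. (n, U, P) \<in> plots ?Z \<and> f x \<in> P ` U" if "x \<in> points X" for x
  proof -
    from X that obtain n U P r where P: "(n, U, P) \<in> plots X" "r \<in> U" "x = P r"
      by (rule points_covered)
    then have "(n, U, f \<circ> P) \<in> plots ?Z"
      using f plots_parametrization(2)[OF X P(1)] by (auto simp: plt smooth_map_def)
    moreover have "f x \<in> (f \<circ> P) ` U" using P by auto
    ultimately show ?thesis by blast
  qed
  moreover have "P ` U \<subseteq> f ` points X" if "(n, U, P) \<in> plots ?Z" for n U P
    using that by (simp add: plt)
  ultimately have "images_cover (plots ?Z) (points ?Z)"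
    unfolding images_cover_iff pts by blast
  moreover have "plots ?Z \<subseteq> parametrizations (points ?Z)"
    using plots_parametrization(1)[OF Y] unfolding parametrizations_def pts
    by (fastforce simp: plt)
  moreover have "(m, V, P \<circ> F) \<in> plots ?Z"
    if "(n, U, P) \<in> plots ?Z" "smooth_between m V n U F" for n U P m V F
    using that plots_comp[OF Y] by (fastforce simp: plt smooth_between_def)
  moreover have "(n, \<Union>(fst ` \<F>), Q) \<in> plots ?Z"
    if "\<forall>(U, P)\<in>\<F>. (n, U, P) \<in> plots ?Z \<and> (\<forall>x\<in>U. Q x = P x)" for n \<F> Q
  proof -
    have "(n, \<Union>(fst ` \<F>), Q) \<in> plots Y"
      by (rule plots_glue[OF Y]) (use that plt in blast)
    moreover have "Q ` \<Union>(fst ` \<F>) \<subseteq> f ` points X" using that by (fastforce simp: plt)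
    ultimately show ?thesis by (simp add: plt)
  qed
  ultimately show ?thesis unfolding diffeological_space_def by blast
qed

section \<open>Pullbacks by plots\<close>

lemma points_pullback_plot:
  "points (pullback_space X f (domain_space n U) P) = {(r, x). r \<in> U \<and> x \<in> points X \<and> P r = f x}"
  by (auto simp: pullback_space_def subspace_of_def product_space_def domain_space_def)

lemma plots_pullback_plot:
  "(m, V, R) \<in> plots (pullback_space X f (domain_space n U) P) \<longleftrightarrow>
     smooth_between m V n U (fst \<circ> R) \<and> (m, V, snd \<circ> R) \<in> plots X \<and>
     R ` V \<subseteq> points (pullback_space X f (domain_space n U) P)"
  unfolding points_pullback_plot
  by (auto simp: pullback_space_def subspace_of_def product_space_def domain_space_def)

lemma smooth_map_fst_pullback:
  "smooth_map (pullback_space X f (domain_space n U) P) (domain_space n U) fst"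
  unfolding smooth_map_def plots_pullback_plot points_pullback_plot
  by (auto simp: domain_space_def)

text \<open>D-openness is tested on the identity plot of \<open>U\<close>.\<close>

lemma d_open_domain_space:
  assumes "d_open (domain_space n U) A" "is_domain n U"
  shows "A \<subseteq> U" "is_domain n A"
proof -
  show AU: "A \<subseteq> U" using assms by (simp add: d_open_def domain_space_def)
  have "(n, U, \<lambda>x. x) \<in> plots (domain_space n U)"
    using assms by (simp add: domain_space_def smooth_between_id)
  with assms have "openin (Euclidean_space n) {r \<in> U. r \<in> A}"
    unfolding d_open_def by fastforce
  moreover have "{r \<in> U. r \<in> A} = A" using AU by blast
  ultimately show "is_domain n A" by (simp add: is_domain_def)
qed

text \<open>The map is composed with the identity plot of \<open>V\<close>. This turns local
  sections and retractions of pullbacks into plots.\<close>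

lemma smooth_map_domain_plot:
  assumes "smooth_map (domain_space n V) X \<sigma>" "is_domain n V"
  shows "(n, V, \<sigma>) \<in> plots X"
proof -
  have "(n, V, \<lambda>x. x) \<in> plots (domain_space n V)"
    using assms(2) by (simp add: domain_space_def smooth_between_id)
  with assms(1) have "(n, V, \<sigma> \<circ> (\<lambda>x. x)) \<in> plots X" unfolding smooth_map_def by blast
  then show ?thesis by (simp add: comp_def)
qed

text \<open>A smooth parametrization in the domain \<open>V\<close> is one in \<open>U\<close> with
  values in \<open>V\<close>, hence a plot of the subspace.\<close>

lemma smooth_map_domain_subspace:
  assumes "smooth_map (subspace_of (domain_space n U) V) X \<sigma>"
    and "is_domain n U" "V \<subseteq> U"
  shows "smooth_map (domain_space n V) X \<sigma>"
  using assms unfolding smooth_map_def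
  by (fastforce simp: domain_space_def subspace_of_def smooth_between_def)

lemma smooth_map_pullback_product:
  assumes "smooth_map Z (pullback_space X f (domain_space n U) P) \<sigma>"
  shows "smooth_map Z (product_space (domain_space n U) X) \<sigma>"
  using assms unfolding smooth_map_def
  by (auto simp: pullback_space_def subspace_of_def)

section \<open>Submersions, immersions and etale maps\<close>

lemma dim_image_submersion_le:
  assumes X: "diffeological_space X" and Y: "diffeological_space Y"
    and f: "diffeological_submersion X Y f"
  shows "diffeological_dim (subspace_of Y (f ` points X)) \<le> diffeological_dim X"
proof (rule diffeological_dim_mono)
  fix \<G> assume \<G>: "covering_generating_family X \<G>"
  let ?Z = "subspace_of Y (f ` points X)"
  define \<H> where "\<H> = (\<lambda>(n, U, P). (n, U, f \<circ> P)) ` \<G>"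
  have sm: "smooth_map X Y f" using f by (simp add: diffeological_submersion_def)
  have "covering_generating_family ?Z \<H>"
  proof (rule covering_generating_familyI)
    show "diffeological_space ?Z" using X Y sm by (rule diffeological_space_image)
    show "\<H> \<subseteq> plots ?Z"
    proof
      fix p assume "p \<in> \<H>"
      then obtain n U P where p: "p = (n, U, f \<circ> P)" and "(n, U, P) \<in> \<G>" by (auto simp: \<H>_def)
      then have P: "(n, U, P) \<in> plots X" using generating_family_subset_plots[OF \<G>] by blast
      with sm plots_parametrization(2)[OF X P] show "p \<in> plots ?Z"
        by (auto simp: p subspace_of_def smooth_map_def)
    qed
    fix n U Q assume "(n, U, Q) \<in> plots ?Z"
    then have Q: "(n, U, Q) \<in> plots Y" "Q ` U \<subseteq> f ` points X" by (auto simp: subspace_of_def)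
    have U: "is_domain n U" using plots_parametrization[OF Y Q(1)] by simp
    let ?E = "pullback_space X f (domain_space n U) Q"
    have sub: "submersion ?E (domain_space n U) fst"
      using f Q(1) unfolding diffeological_submersion_def by fast
    show "locally_factors \<H> (n, U, Q)"
    proof (unfold locally_factors_iff, rule ballI)
      fix r assume r: "r \<in> U"
      \<comment> \<open>Since \<open>Q\<close> has values in the image of \<open>f\<close>, the
        fibre of the pullback over \<open>r\<close> is nonempty, which provides a point for the
        section to pass through.\<close>
      then obtain x where "x \<in> points X" "Q r = f x" using Q(2) by blast
      with r have "(r, x) \<in> points ?E" by (simp add: points_pullback_plot)
      with sub obtain A \<sigma> where A: "d_open (domain_space n U) A"
        and \<sigma>: "smooth_map (subspace_of (domain_space n U) A) ?E \<sigma>"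
        and sec: "\<forall>y\<in>A. fst (\<sigma> y) = y" and im: "(r, x) \<in> \<sigma> ` A"
        unfolding submersion_def by meson
      have AU: "A \<subseteq> U" "is_domain n A" using d_open_domain_space[OF A U] .
      \<comment> \<open>If \<open>(r, x) = \<sigma> y\<close> with \<open>y\<close> in
        \<open>A\<close>, the section property gives \<open>y = r\<close>.\<close>
      have rA: "r \<in> A" using im sec by (metis fst_conv imageE)
      have "(n, A, \<sigma>) \<in> plots ?E"
        using smooth_map_domain_plot[OF smooth_map_domain_subspace[OF \<sigma> U AU(1)] AU(2)] .
      then have lift: "(n, A, snd \<circ> \<sigma>) \<in> plots X" and "\<sigma> ` A \<subseteq> points ?E"
        by (simp_all add: plots_pullback_plot)
      then have fQ: "Q s = f (snd (\<sigma> s))" if "s \<in> A" for s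
        using that sec by (fastforce simp: points_pullback_plot)
      \<comment> \<open>The lift \<open>snd \<circ> \<sigma>\<close> factors through a member
        \<open>P\<close> of \<open>\<G>\<close> near \<open>r\<close>; applying \<open>f\<close>
        gives a factorization of \<open>Q\<close> through \<open>f \<circ> P\<close>.\<close>
      from generating_family_locally_factors[OF \<G> lift] rA
      obtain V m W P F where *: "is_domain n V" "r \<in> V" "V \<subseteq> A" "(m, W, P) \<in> \<G>"
        "smooth_between n V m W F" "\<And>s. s \<in> V \<Longrightarrow> (snd \<circ> \<sigma>) s = P (F s)"
        by (rule locally_factorsE) blast
      have "(m, W, f \<circ> P) \<in> \<H>" using *(4) by (force simp: \<H>_def)
      moreover have "\<forall>s\<in>V. Q s = (f \<circ> P) (F s)" using *(3,6) fQ by fastforce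
      ultimately show "\<exists>V m W P F. is_domain n V \<and> r \<in> V \<and> V \<subseteq> U \<and> (m, W, P) \<in> \<H> \<and>
          smooth_between n V m W F \<and> (\<forall>s\<in>V. Q s = P (F s))"
        using * AU by blast
    qed
  qed
  moreover have "fst ` \<H> \<subseteq> fst ` \<G>" by (force simp: \<H>_def)
  ultimately show "\<exists>\<H>. covering_generating_family ?Z \<H> \<and> fst ` \<H> \<subseteq> fst ` \<G>" by blast
qed

section \<open>Immersions: plots of the source recovered by retractions\<close>

lemma immersionE:
  assumes "diffeological_immersion X Y f" "(n, U, P) \<in> plots Y"
    and "p0 \<in> points (pullback_space X f (domain_space n U) P)"
  obtains A V \<rho> where "d_open (pullback_space X f (domain_space n U) P) A" "p0 \<in> A"
    "is_domain n V" "V \<subseteq> U" "fst ` A \<subseteq> V"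
    "smooth_map (domain_space n V) (product_space (domain_space n U) X) \<rho>"
    "\<forall>p\<in>A. \<rho> (fst p) = p"
proof -
  have "\<forall>p0\<in>points (pullback_space X f (domain_space n U) P).
        \<exists>A V \<rho>. d_open (pullback_space X f (domain_space n U) P) A \<and> p0 \<in> A \<and>
          is_domain n V \<and> V \<subseteq> U \<and> fst ` A \<subseteq> V \<and>
          smooth_map (domain_space n V) (product_space (domain_space n U) X) \<rho> \<and>
          (\<forall>p\<in>A. \<rho> (fst p) = p)"
    using assms(1,2) unfolding diffeological_immersion_def by fast
  from bspec[OF this assms(3)] show ?thesis by (elim exE conjE) (rule that)
qed

lemma dim_immersion_le:
  assumes X: "diffeological_space X" and f: "diffeological_immersion X Y f"
  shows "diffeological_dim X \<le> diffeological_dim Y"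
proof (rule diffeological_dim_mono)
  fix \<G> assume \<G>: "covering_generating_family Y \<G>"
  define \<H> where "\<H> = {p \<in> plots X. fst p \<in> fst ` \<G>}"
  have sm: "smooth_map X Y f" using f by (simp add: diffeological_immersion_def)
  have "covering_generating_family X \<H>"
  proof (rule covering_generating_familyI[OF X])
    show "\<H> \<subseteq> plots X" by (auto simp: \<H>_def)
    fix m W Q assume Q: "(m, W, Q) \<in> plots X"
    then have fQ: "(m, W, f \<circ> Q) \<in> plots Y" using sm by (simp add: smooth_map_def)
    show "locally_factors \<H> (m, W, Q)"
    proof (unfold locally_factors_iff, rule ballI)
      fix r assume "r \<in> W"
      with generating_family_locally_factors[OF \<G> fQ]
      obtain W' n U P F where W': "is_domain m W'" "r \<in> W'" "W' \<subseteq> W" and P: "(n, U, P) \<in> \<G>"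
        and F: "smooth_between m W' n U F" and PF: "\<And>s. s \<in> W' \<Longrightarrow> (f \<circ> Q) s = P (F s)"
        by (rule locally_factorsE) blast
      let ?E = "pullback_space X f (domain_space n U) P"
      \<comment> \<open>The equation \<open>f \<circ> Q = P \<circ> F\<close> on \<open>W'\<close>
        says that this pair takes values in the pullback by \<open>P\<close>, so it is a plot
        there.\<close>
      define R where "R = (\<lambda>s. (F s, Q s))"
      have "R ` W' \<subseteq> points ?E"
        using F PF W' plots_parametrization(2)[OF X Q]
        by (fastforce simp: R_def points_pullback_plot smooth_between_def)
      moreover have "(m, W', Q) \<in> plots X" using plots_restrict[OF X Q W'(1,3)] .
      ultimately have R: "(m, W', R) \<in> plots ?E"
        using F by (simp add: plots_pullback_plot R_def comp_def)
      have Rr: "R r \<in> points ?E" using \<open>R ` W' \<subseteq> points ?E\<close> W' by blast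
      have "(n, U, P) \<in> plots Y" using P generating_family_subset_plots[OF \<G>] by blast
      from f this Rr obtain A V \<rho> where A: "d_open ?E A" "R r \<in> A"
        and V: "is_domain n V" "V \<subseteq> U" "fst ` A \<subseteq> V"
        and \<rho>: "smooth_map (domain_space n V) (product_space (domain_space n U) X) \<rho>"
        and ret: "\<forall>p\<in>A. \<rho> (fst p) = p"
        by (rule immersionE)
      have "(n, V, snd \<circ> \<rho>) \<in> plots X"
        using smooth_map_domain_plot[OF \<rho> V(1)] by (simp add: product_space_def)
      moreover have "n \<in> fst ` \<G>" using P by (rule image_eqI[rotated]) simp
      ultimately have "(n, V, snd \<circ> \<rho>) \<in> \<H>" by (simp add: \<H>_def)
      \<comment> \<open>The retraction identity is only available on \<open>A\<close>; the preimage
        of the D-open set \<open>A\<close> under the plot \<open>R\<close> is an open neighborhood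
        of \<open>r\<close>.\<close>
      moreover define W'' where "W'' = {s \<in> W'. R s \<in> A}"
      have W'': "is_domain m W''"
        using A(1) R unfolding d_open_def is_domain_def W''_def by fastforce
      moreover have "smooth_between m W'' n V F"
        using F W'' _ V(1)
      proof (rule smooth_between_subset)
        show "W'' \<subseteq> W'" by (auto simp: W''_def)
        show "F ` W'' \<subseteq> V" using V(3) by (force simp: W''_def R_def)
      qed
      \<comment> \<open>For \<open>R s\<close> in \<open>A\<close> the retraction gives
        \<open>\<rho> (F s) = R s = (F s, Q s)\<close>.\<close>
      moreover have "\<forall>s\<in>W''. Q s = (snd \<circ> \<rho>) (F s)"
        using ret by (fastforce simp: W''_def R_def)
      moreover have "r \<in> W''" "W'' \<subseteq> W" using W' A(2) by (auto simp: W''_def)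
      ultimately show "\<exists>V n U P F. is_domain m V \<and> r \<in> V \<and> V \<subseteq> W \<and> (n, U, P) \<in> \<H> \<and>
          smooth_between m V n U F \<and> (\<forall>s\<in>V. Q s = P (F s))"
        by blast
    qed
  qed
  moreover have "fst ` \<H> \<subseteq> fst ` \<G>" by (auto simp: \<H>_def)
  ultimately show "\<exists>\<H>. covering_generating_family X \<H> \<and> fst ` \<H> \<subseteq> fst ` \<G>" by blast
qed

section \<open>Etale maps as submersions and immersions\<close>

text \<open>The inverse \<open>\<sigma>\<close> of the local diffeomorphism \<open>fst\<close> from
  \<open>A\<close> to \<open>B\<close> is two-sided: one identity makes it a section through
  \<open>p0\<close>, the other a retraction on \<open>A\<close>.\<close>

lemma etale_pullback_section:
  assumes "etale_map (pullback_space X f (domain_space n U) P) (domain_space n U) fst"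
    and U: "is_domain n U"
    and p0: "p0 \<in> points (pullback_space X f (domain_space n U) P)"
  obtains A B \<sigma> where "d_open (pullback_space X f (domain_space n U) P) A" "p0 \<in> A"
    "d_open (domain_space n U) B" "fst ` A = B"
    "smooth_map (subspace_of (domain_space n U) B) (pullback_space X f (domain_space n U) P) \<sigma>"
    "\<And>r. r \<in> B \<Longrightarrow> fst (\<sigma> r) = r" "\<And>p. p \<in> A \<Longrightarrow> \<sigma> (fst p) = p"
proof -
  let ?E = "pullback_space X f (domain_space n U) P"
  let ?U = "domain_space n U"
  from assms(1) p0 obtain A B where A: "d_open ?E A" "p0 \<in> A" and B: "d_open ?U B"
    and diffeo: "diffeomorphism (subspace_of ?E A) (subspace_of ?U B) fst"
    unfolding etale_map_def by meson
  define \<sigma> where "\<sigma> = inv_into A fst"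
  \<comment> \<open>D-open sets consist of points of the space, so the inverse in
    \<open>diffeomorphism\<close> is exactly \<open>\<sigma>\<close>.\<close>
  have "points (subspace_of ?E A) = A" "points (subspace_of ?U B) = B"
    using A(1) B by (auto simp: subspace_of_def d_open_def)
  with diffeo have bij: "bij_betw fst A B"
    and "smooth_map (subspace_of ?U B) (subspace_of ?E A) \<sigma>"
    by (simp_all add: diffeomorphism_def \<sigma>_def)
  then have "smooth_map (subspace_of ?U B) ?E \<sigma>"
    by (auto simp: smooth_map_def subspace_of_def)
  with A B bij show ?thesis
    by (intro that[of A B \<sigma>])
      (auto simp: \<sigma>_def bij_betw_imp_surj_on bij_betw_inv_into_left bij_betw_inv_into_right)
qed

lemma etale_imp_submersion:
  assumes Y: "diffeological_space Y" and f: "diffeological_etale_map X Y f"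
  shows "diffeological_submersion X Y f"
proof -
  have "submersion (pullback_space X f (domain_space n U) P) (domain_space n U) fst"
    if P: "(n, U, P) \<in> plots Y" for n U P
    unfolding submersion_def
  proof (intro conjI ballI smooth_map_fst_pullback)
    let ?E = "pullback_space X f (domain_space n U) P"
    fix p0 assume p0: "p0 \<in> points ?E"
    have "etale_map ?E (domain_space n U) fst"
      using f P unfolding diffeological_etale_map_def by fast
    from this plots_parametrization(1)[OF Y P] p0 obtain A B \<sigma> where *: "d_open ?E A" "p0 \<in> A"
      "d_open (domain_space n U) B" "fst ` A = B"
      "smooth_map (subspace_of (domain_space n U) B) ?E \<sigma>"
      "\<And>r. r \<in> B \<Longrightarrow> fst (\<sigma> r) = r" "\<And>p. p \<in> A \<Longrightarrow> \<sigma> (fst p) = p"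
      by (rule etale_pullback_section) blast
    \<comment> \<open>Indeed \<open>p0 = \<sigma> (fst p0)\<close> with \<open>fst p0\<close> in
      \<open>B\<close>.\<close>
    then have "p0 \<in> \<sigma> ` B" by (metis imageI)
    with * show "\<exists>A \<sigma>. d_open (domain_space n U) A \<and>
        smooth_map (subspace_of (domain_space n U) A) ?E \<sigma> \<and>
        (\<forall>y\<in>A. fst (\<sigma> y) = y) \<and> p0 \<in> \<sigma> ` A"
      by blast
  qed
  then show ?thesis
    using f unfolding diffeological_submersion_def diffeological_etale_map_def by auto
qed

lemma etale_imp_immersion:
  assumes Y: "diffeological_space Y" and f: "diffeological_etale_map X Y f"
  shows "diffeological_immersion X Y f"
proof -
  have "\<exists>A V \<rho>. d_open (pullback_space X f (domain_space n U) P) A \<and> p0 \<in> A \<and>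
          is_domain n V \<and> V \<subseteq> U \<and> fst ` A \<subseteq> V \<and>
          smooth_map (domain_space n V) (product_space (domain_space n U) X) \<rho> \<and>
          (\<forall>p\<in>A. \<rho> (fst p) = p)"
    if P: "(n, U, P) \<in> plots Y" and p0: "p0 \<in> points (pullback_space X f (domain_space n U) P)"
    for n U P p0
  proof -
    let ?E = "pullback_space X f (domain_space n U) P"
    have U: "is_domain n U" using Y P by (rule plots_parametrization)
    have "etale_map ?E (domain_space n U) fst"
      using f P unfolding diffeological_etale_map_def by fast
    from this U p0 obtain A B \<sigma> where *: "d_open ?E A" "p0 \<in> A"
      "d_open (domain_space n U) B" "fst ` A = B"
      "smooth_map (subspace_of (domain_space n U) B) ?E \<sigma>"
      "\<And>r. r \<in> B \<Longrightarrow> fst (\<sigma> r) = r" "\<And>p. p \<in> A \<Longrightarrow> \<sigma> (fst p) = p"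
      by (rule etale_pullback_section) blast
    have B: "B \<subseteq> U" "is_domain n B" using d_open_domain_space[OF *(3) U] .
    \<comment> \<open>The local inverse serves as the retraction with \<open>V = B\<close>; its
      values in the pullback are regarded as values in the product.\<close>
    have "smooth_map (domain_space n B) (product_space (domain_space n U) X) \<sigma>"
      using smooth_map_domain_subspace[OF smooth_map_pullback_product[OF *(5)] U B(1)] .
    with * B show ?thesis by blast
  qed
  then show ?thesis
    using f unfolding diffeological_immersion_def diffeological_etale_map_def by auto
qed

text \<open>Plots of the image are plots of \<open>Y\<close>, and the pullback by such a plot is the
  same space for both targets, so the local condition carries over.\<close>

lemma immersion_onto_image:
  assumes X: "diffeological_space X" and f: "diffeological_immersion X Y f"
  shows "diffeological_immersion X (subspace_of Y (f ` points X)) f"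
proof -
  have "smooth_map X (subspace_of Y (f ` points X)) f"
    using f plots_parametrization(2)[OF X]
    by (fastforce simp: diffeological_immersion_def smooth_map_def subspace_of_def)
  moreover have "plots (subspace_of Y (f ` points X)) \<subseteq> plots Y"
    by (auto simp: subspace_of_def)
  ultimately show ?thesis using f unfolding diffeological_immersion_def by blast
qed

theorem propositionB:
  fixes X :: "'a dspace" and Y :: "'b dspace" and f :: "'a \<Rightarrow> 'b"
  assumes "diffeological_space X" and "diffeological_space Y" and "smooth_map X Y f"
  shows
    "(diffeological_submersion X Y f \<longrightarrow>
        diffeological_dim X \<ge> diffeological_dim (subspace_of Y (f ` points X))) \<and>
     (diffeological_immersion X Y f \<longrightarrow>
        diffeological_dim X \<le> diffeological_dim Y) \<and>
     (diffeological_etale_map X Y f \<longrightarrow>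
        diffeological_dim X = diffeological_dim (subspace_of Y (f ` points X)) \<and>
        diffeological_dim (subspace_of Y (f ` points X)) \<le> diffeological_dim Y)"
proof (intro conjI impI)
  assume "diffeological_submersion X Y f"
  with assms show "diffeological_dim (subspace_of Y (f ` points X)) \<le> diffeological_dim X"
    by (intro dim_image_submersion_le)
next
  assume "diffeological_immersion X Y f"
  with assms show "diffeological_dim X \<le> diffeological_dim Y"
    by (intro dim_immersion_le)
next
  assume etale: "diffeological_etale_map X Y f"
  have sub: "diffeological_dim (subspace_of Y (f ` points X)) \<le> diffeological_dim X"
    using dim_image_submersion_le etale_imp_submersion assms etale by blast
  have imm: "diffeological_immersion X Y f"
    using etale_imp_immersion assms etale by blast
  \<comment> \<open>The immersion inequality is applied with the image as target, which gives the
    converse of \<open>sub\<close>.\<close>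
  show "diffeological_dim X = diffeological_dim (subspace_of Y (f ` points X))"
    using sub dim_immersion_le[OF assms(1) immersion_onto_image[OF assms(1) imm]]
    by (rule antisym[rotated])
  show "diffeological_dim (subspace_of Y (f ` points X)) \<le> diffeological_dim Y"
    using sub dim_immersion_le[OF assms(1) imm] by (rule order_trans)
qed

end
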